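(* Let $\Pi$ be a projective plane of order $p^2$, $p\geq 3$ prime, and let $c\in\mathrm{C}(\Pi)^\perp$ have weight $2p^2-2p+2+\epsilon$ with $1\leq\epsilon\leq p-2$, such that every non-zero entry of $c$ is $1$ or $p-1$. Let $K_1$ and $K_{p-1}$ be the sets of points at which $c$ has entry $1$ and $p-1$ respectively. If $\bigl||K_1|-|K_{p-1}|\bigr|=p$, then $\Pi$ contains a Baer subplane $\mathcal{B}$ (a subplane of order $p$) and a line $\ell$ of $\Pi$ meeting $\mathcal{B}$ in $p+1$ points such that $c=v_{\mathcal{B}}-v_\ell$ or $c=v_\ell-v_{\mathcal{B}}$, where $v_{\mathcal{B}}$ and $v_\ell$ are the incidence vectors of the point sets of $\mathcal{B}$ and $\ell$.
   Context: $\mathrm{C}(\Pi)$ is the $\mathbb{F}_p$-span of the incidence vectors of the lines of $\Pi$, viewed as vectors in $\mathbb{F}_p^{p^4+p^2+1}$ indexed by points; $\mathrm{C}(\Pi)^\perp$ is the set of vectors $v$ with $\sum_{P\in\ell}v_P=0$ in $\mathbb{F}_p$ for every line $\ell$. Elements of $\mathbb{F}_p$ are represented by integers in $\{0,\dots,p-1\}$. The weight is the number of non-zero positions. *)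

theory Defs
  imports "HOL-Number_Theory.Number_Theory" "HOL-Library.FuncSet"
begin

text \<open>Incidence structures are given by a set of points, a set of lines and an incidence relation.\<close>

definition line_points :: "'a set \<Rightarrow> ('a \<Rightarrow> 'b \<Rightarrow> bool) \<Rightarrow> 'b \<Rightarrow> 'a set" where
  "line_points P I l = {x \<in> P. I x l}"

definition projective_plane :: "'a set \<Rightarrow> 'b set \<Rightarrow> ('a \<Rightarrow> 'b \<Rightarrow> bool) \<Rightarrow> bool" where
  "projective_plane P L I \<longleftrightarrow>
     (\<forall>x\<in>P. \<forall>y\<in>P. x \<noteq> y \<longrightarrow> (\<exists>!l. l \<in> L \<and> I x l \<and> I y l)) \<and>
     (\<forall>l\<in>L. \<forall>m\<in>L. l \<noteq> m \<longrightarrow> (\<exists>!x. x \<in> P \<and> I x l \<and> I x m)) \<and>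
     (\<exists>Q\<subseteq>P. card Q = 4 \<and> (\<forall>l\<in>L. card {x \<in> Q. I x l} \<le> 2))"

definition projective_plane_of_order ::
  "nat \<Rightarrow> 'a set \<Rightarrow> 'b set \<Rightarrow> ('a \<Rightarrow> 'b \<Rightarrow> bool) \<Rightarrow> bool" where
  "projective_plane_of_order n P L I \<longleftrightarrow>
     projective_plane P L I \<and> (\<forall>l\<in>L. card (line_points P I l) = n + 1)"

definition subplane_of_order ::
  "nat \<Rightarrow> 'a set \<Rightarrow> 'b set \<Rightarrow> 'a set \<Rightarrow> 'b set \<Rightarrow> ('a \<Rightarrow> 'b \<Rightarrow> bool) \<Rightarrow> bool" where
  "subplane_of_order n B M P L I \<longleftrightarrow>
     B \<subseteq> P \<and> M \<subseteq> L \<and> projective_plane_of_order n B M I"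

text \<open>
  Elements of the field with \<open>p\<close> elements are represented by the integers \<open>0, \<dots>, p - 1\<close>.
  Vectors are extensional functions (\<open>undefined\<close> outside \<open>P\<close>), so that equality of vectors is
  equality of functions.
\<close>

definition Fp_vectors :: "nat \<Rightarrow> 'a set \<Rightarrow> ('a \<Rightarrow> int) set" where
  "Fp_vectors p P = P \<rightarrow>\<^sub>E {0..<int p}"

definition incidence_vector :: "'a set \<Rightarrow> 'a set \<Rightarrow> 'a \<Rightarrow> int" where
  "incidence_vector P S = (\<lambda>x\<in>P. if x \<in> S then 1 else 0)"

definition vec_diff :: "nat \<Rightarrow> 'a set \<Rightarrow> ('a \<Rightarrow> int) \<Rightarrow> ('a \<Rightarrow> int) \<Rightarrow> 'a \<Rightarrow> int" where
  "vec_diff p P u v = (\<lambda>x\<in>P. (u x - v x) mod int p)"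

definition weight :: "'a set \<Rightarrow> ('a \<Rightarrow> int) \<Rightarrow> nat" where
  "weight P v = card {x \<in> P. v x \<noteq> 0}"

definition line_code :: "nat \<Rightarrow> 'a set \<Rightarrow> 'b set \<Rightarrow> ('a \<Rightarrow> 'b \<Rightarrow> bool) \<Rightarrow> ('a \<Rightarrow> int) set" where
  "line_code p P L I =
     {\<lambda>x\<in>P. (\<Sum>l\<in>L. a l * incidence_vector P (line_points P I l) x) mod int p | a :: 'b \<Rightarrow> int. True}"

definition dual_code :: "nat \<Rightarrow> 'a set \<Rightarrow> 'b set \<Rightarrow> ('a \<Rightarrow> 'b \<Rightarrow> bool) \<Rightarrow> ('a \<Rightarrow> int) set" where
  "dual_code p P L I =
     {v \<in> Fp_vectors p P. \<forall>l\<in>L. [(\<Sum>x\<in>line_points P I l. v x) = 0] (mod int p)}"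

lemma dual_code_eq_orthogonal_complement:
  assumes "finite P" "finite L"
  shows "dual_code p P L I =
    {v \<in> Fp_vectors p P. \<forall>u\<in>line_code p P L I. [(\<Sum>x\<in>P. u x * v x) = 0] (mod int p)}"
proof -
  let ?i = "\<lambda>l. incidence_vector P (line_points P I l)"
  have line: "(\<Sum>x\<in>P. ?i l x * v x) = (\<Sum>x\<in>line_points P I l. v x)" for l and v :: "'a \<Rightarrow> int"
  proof -
    have "(\<Sum>x\<in>P. ?i l x * v x) = (\<Sum>x\<in>P. if x \<in> line_points P I l then v x else 0)"
      by (rule sum.cong) (auto simp: incidence_vector_def)
    also have "\<dots> = (\<Sum>x\<in>P \<inter> line_points P I l. v x)"
      using assms(1) by (simp add: sum.inter_restrict)
    also have "P \<inter> line_points P I l = line_points P I l"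
      by (auto simp: line_points_def)
    finally show ?thesis .
  qed
  have comb: "[(\<Sum>x\<in>P. (\<lambda>x\<in>P. (\<Sum>l\<in>L. a l * ?i l x) mod int p) x * v x)
      = (\<Sum>l\<in>L. a l * (\<Sum>x\<in>line_points P I l. v x))] (mod int p)"
    for a :: "'b \<Rightarrow> int" and v :: "'a \<Rightarrow> int"
  proof -
    have "[(\<Sum>x\<in>P. (\<lambda>x\<in>P. (\<Sum>l\<in>L. a l * ?i l x) mod int p) x * v x)
      = (\<Sum>x\<in>P. (\<Sum>l\<in>L. a l * ?i l x) * v x)] (mod int p)"
      by (rule cong_sum) (simp add: cong_def mod_mult_left_eq)
    also have "(\<Sum>x\<in>P. (\<Sum>l\<in>L. a l * ?i l x) * v x) = (\<Sum>x\<in>P. \<Sum>l\<in>L. a l * (?i l x * v x))"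
      by (simp add: sum_distrib_right mult.assoc)
    also have "\<dots> = (\<Sum>l\<in>L. a l * (\<Sum>x\<in>P. ?i l x * v x))"
      by (subst sum.swap) (simp add: sum_distrib_left)
    finally show ?thesis by (simp add: line)
  qed
  have "(\<forall>l\<in>L. [(\<Sum>x\<in>line_points P I l. v x) = 0] (mod int p)) \<longleftrightarrow>
    (\<forall>u\<in>line_code p P L I. [(\<Sum>x\<in>P. u x * v x) = 0] (mod int p))" (is "?A \<longleftrightarrow> ?B") for v
  proof
    assume A: ?A
    show ?B
    proof
      fix u assume "u \<in> line_code p P L I"
      then obtain a where u: "u = (\<lambda>x\<in>P. (\<Sum>l\<in>L. a l * ?i l x) mod int p)"
        by (auto simp: line_code_def)
      have "[(\<Sum>l\<in>L. a l * (\<Sum>x\<in>line_points P I l. v x)) = (\<Sum>l\<in>L. a l * 0)] (mod int p)"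
        using A by (intro cong_sum cong_scalar_left) auto
      from cong_trans[OF comb[of a v] this] show "[(\<Sum>x\<in>P. u x * v x) = 0] (mod int p)"
        by (simp only: u mult_zero_right sum.neutral_const)
    qed
  next
    assume B: ?B
    show ?A
    proof
      fix l assume l: "l \<in> L"
      define a where "a = (\<lambda>m. if m = l then 1 else 0 :: int)"
      let ?u = "\<lambda>x\<in>P. (\<Sum>m\<in>L. a m * ?i m x) mod int p"
      have "?u \<in> line_code p P L I" by (auto simp: line_code_def)
      with B have "[(\<Sum>x\<in>P. ?u x * v x) = 0] (mod int p)" by blast
      from cong_trans[OF cong_sym[OF comb[of a v]] this] have
        "[(\<Sum>m\<in>L. a m * (\<Sum>x\<in>line_points P I m. v x)) = 0] (mod int p)"
        .
      moreover have "(\<Sum>m\<in>L. a m * (\<Sum>x\<in>line_points P I m. v x)) =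
          (\<Sum>m\<in>L. if m = l then (\<Sum>x\<in>line_points P I m. v x) else 0)"
        by (rule sum.cong) (auto simp: a_def)
      ultimately show "[(\<Sum>x\<in>line_points P I l. v x) = 0] (mod int p)"
        using l assms(2) by simp
    qed
  qed
  then show ?thesis by (auto simp: dual_code_def)
qed

end

theory Submission
  imports Defs
begin

text \<open>
  Up to sign, \<open>A = K\<^sub>1\<close> has \<open>p\<close> points more than \<open>B = K\<^bsub>p-1\<^esub>\<close>. A line \<open>l\<close> meeting \<open>A\<close> satisfies
  \<open>|A \<inter> l| + (p - 1) |B \<inter> l| \<ge> p\<close>, because \<open>|A \<inter> l| \<equiv> |B \<inter> l|\<close> modulo \<open>p\<close>. Summing over the
  lines through a point of \<open>A\<close> gives \<open>|B| \<ge> p\<^sup>2 - p\<close>, and the weight bound gives the converse.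
  Hence equality holds throughout: a line meeting \<open>A\<close> meets \<open>(A, B)\<close> in \<open>(1, 1)\<close> or \<open>(p, 0)\<close>
  points. The \<open>p\<^sup>2\<close> lines joining a point of \<open>B\<close> to the points of \<open>A\<close> contain no further point
  of \<open>B\<close>, so \<open>B\<close> lies on the one remaining line \<open>\<ell>\<close>, and \<open>A \<union> (\<ell> - B)\<close> is a Baer subplane.
\<close>

section \<open>Counting along the lines through a point of a plane of order \<open>n\<close>\<close>

locale plane_of_order =
  fixes n :: nat and P :: "'a set" and L :: "'b set" and I :: "'a \<Rightarrow> 'b \<Rightarrow> bool"
  assumes plane: "projective_plane_of_order n P L I"
begin

abbreviation pts :: "'b \<Rightarrow> 'a set" where "pts \<equiv> line_points P I"

definition pencil :: "'a \<Rightarrow> 'b set" where "pencil x = {l \<in> L. x \<in> pts l}"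

lemma pts_iff: "x \<in> pts l \<longleftrightarrow> x \<in> P \<and> I x l"
  by (simp add: line_points_def)

lemma pts_subset: "pts l \<subseteq> P"
  by (auto simp: pts_iff)

lemma card_pts: "l \<in> L \<Longrightarrow> card (pts l) = n + 1"
  using plane by (simp add: projective_plane_of_order_def)

lemma finite_pts: "l \<in> L \<Longrightarrow> finite (pts l)"
  using card_pts by (metis Suc_eq_plus1 card.infinite nat.distinct(1))

lemma join_exists:
  assumes "x \<in> P" "y \<in> P" "x \<noteq> y"
  obtains l where "l \<in> L" "x \<in> pts l" "y \<in> pts l"
  using plane assms unfolding projective_plane_of_order_def projective_plane_def pts_iff by metis

lemma join_unique:
  assumes "l \<in> L" "m \<in> L" "x \<noteq> y" "x \<in> pts l" "y \<in> pts l" "x \<in> pts m" "y \<in> pts m"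
  shows "l = m"
  using plane assms unfolding projective_plane_of_order_def projective_plane_def pts_iff by metis

lemma meet_exists:
  assumes "l \<in> L" "m \<in> L" "l \<noteq> m"
  obtains x where "x \<in> pts l" "x \<in> pts m"
  using plane assms unfolding projective_plane_of_order_def projective_plane_def pts_iff by metis

text \<open>A quadrangle has at least three points \<open>a\<close>, \<open>b\<close>,
  \<open>d\<close> other than \<open>x\<close>. The lines \<open>ab\<close> and \<open>ad\<close>
  are distinct and share only \<open>a\<close>, so one of them misses \<open>x\<close>.\<close>

lemma line_avoiding:
  obtains l where "l \<in> L" "x \<notin> pts l"
proof -
  obtain Q where Q: "Q \<subseteq> P" "card Q = 4" "\<And>l. l \<in> L \<Longrightarrow> card {x \<in> Q. I x l} \<le> 2"
    using plane unfolding projective_plane_of_order_def projective_plane_def by metis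
  have fin: "finite Q" using Q(2) by (metis card.infinite zero_neq_numeral)
  have "3 \<le> card (Q - {x})"
    using Q(2) fin by (simp add: card_Diff_singleton_if)
  then obtain T where T: "T \<subseteq> Q - {x}" "card T = 3"
    using obtain_subset_with_card_n by metis
  then obtain a b d where abd: "T = {a, b, d}" "a \<noteq> b" "a \<noteq> d" "b \<noteq> d"
    by (auto simp: card_3_iff)
  have P: "a \<in> P" "b \<in> P" "d \<in> P" using T abd Q(1) by auto
  obtain l where l: "l \<in> L" "a \<in> pts l" "b \<in> pts l" using join_exists P abd by metis
  obtain m where m: "m \<in> L" "a \<in> pts m" "d \<in> pts m" using join_exists P abd by metis
  have "l \<noteq> m"
  proof
    assume "l = m"
    then have "T \<subseteq> {x \<in> Q. I x l}" using T abd l m by (auto simp: pts_iff)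
    then have "card T \<le> card {x \<in> Q. I x l}" using fin by (intro card_mono) auto
    then show False using Q(3)[OF l(1)] T(2) by simp
  qed
  moreover have "a \<noteq> x" using T abd by auto
  ultimately have "x \<notin> pts l \<or> x \<notin> pts m" using join_unique l m by metis
  then show thesis using that l m by blast
qed

lemma pencil_disjoint:
  assumes "l \<in> pencil x" "m \<in> pencil x" "l \<noteq> m"
  shows "(pts l - {x}) \<inter> (pts m - {x}) = {}"
  using assms join_unique unfolding pencil_def by blast

text \<open>Projection from \<open>x\<close> is a bijection from the points of a line missing
  \<open>x\<close> to the lines through \<open>x\<close>. Finiteness is derived here as well, from
  that of a single line.\<close>

lemma finite_card_pencil:
  assumes x: "x \<in> P"
  shows "finite (pencil x) \<and> card (pencil x) = n + 1"
proof -
  obtain l where l: "l \<in> L" "x \<notin> pts l" using line_avoiding .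
  define j where "j y = (SOME m. m \<in> L \<and> x \<in> pts m \<and> y \<in> pts m)" for y
  have j: "j y \<in> L \<and> x \<in> pts (j y) \<and> y \<in> pts (j y)" if "y \<in> pts l" for y
  proof -
    have "\<exists>m. m \<in> L \<and> x \<in> pts m \<and> y \<in> pts m"
      using join_exists[of x y] that x l pts_iff by metis
    then show ?thesis unfolding j_def by (rule someI_ex)
  qed
  have "bij_betw j (pts l) (pencil x)"
  proof (rule bij_betw_imageI)
    show "inj_on j (pts l)"
      using j join_unique l unfolding inj_on_def by metis
    show "j ` pts l = pencil x"
    proof (intro equalityI subsetI)
      fix m assume m: "m \<in> pencil x"
      then obtain y where y: "y \<in> pts l" "y \<in> pts m"
        using meet_exists[of l m] l by (auto simp: pencil_def)
      then have "m = j y"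
        using j[OF y(1)] m l join_unique[of m "j y" x y] by (auto simp: pencil_def)
      then show "m \<in> j ` pts l" using y by blast
    qed (use j in \<open>auto simp: pencil_def\<close>)
  qed
  then show ?thesis
    using bij_betw_finite bij_betw_same_card card_pts finite_pts l by metis
qed

lemma pencil_partition:
  assumes "x \<in> P" "S \<subseteq> P" "x \<notin> S"
  shows "S = (\<Union>l\<in>pencil x. S \<inter> pts l)"
proof
  show "S \<subseteq> (\<Union>l\<in>pencil x. S \<inter> pts l)"
  proof
    fix y assume "y \<in> S"
    moreover from this obtain l where "l \<in> L" "x \<in> pts l" "y \<in> pts l"
      using join_exists[of x y] assms by blast
    ultimately show "y \<in> (\<Union>l\<in>pencil x. S \<inter> pts l)" by (auto simp: pencil_def)
  qed
qed auto

lemma sum_pencil: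
  assumes "x \<in> P" "S \<subseteq> P" "x \<notin> S" "finite S"
  shows "(\<Sum>l\<in>pencil x. card (S \<inter> pts l)) = card S"
proof -
  have "card (\<Union>l\<in>pencil x. S \<inter> pts l) = (\<Sum>l\<in>pencil x. card (S \<inter> pts l))"
  proof (intro card_UN_disjoint ballI impI)
    fix l m assume "l \<in> pencil x" "m \<in> pencil x" "l \<noteq> m"
    from pencil_disjoint[OF this] show "S \<inter> pts l \<inter> (S \<inter> pts m) = {}" using assms(3) by blast
  qed (use finite_card_pencil assms in auto)
  then show ?thesis using pencil_partition[OF assms(1-3)] by simp
qed

text \<open>The point \<open>x\<close> is counted on all \<open>n + 1\<close> lines and every other
  point of \<open>S\<close> once, hence the surplus \<open>n\<close>.\<close>

lemma sum_pencil_self: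
  assumes "x \<in> S" "S \<subseteq> P" "finite S"
  shows "(\<Sum>l\<in>pencil x. card (S \<inter> pts l)) = card S + n"
proof -
  have x: "x \<in> P" using assms by auto
  have "(\<Sum>l\<in>pencil x. card (S \<inter> pts l)) = (\<Sum>l\<in>pencil x. card ((S - {x}) \<inter> pts l) + 1)"
  proof (rule sum.cong)
    fix l assume "l \<in> pencil x"
    then have "S \<inter> pts l = insert x ((S - {x}) \<inter> pts l)" using assms by (auto simp: pencil_def)
    then show "card (S \<inter> pts l) = card ((S - {x}) \<inter> pts l) + 1" using assms by simp
  qed simp
  also have "\<dots> = card (S - {x}) + (n + 1)"
    using sum_pencil[of x "S - {x}"] x assms finite_card_pencil[OF x]
    by (subst sum.distrib) auto
  also have "\<dots> = card S + n"
    using assms card_Suc_Diff1[of S x] by simp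
  finally show ?thesis .
qed

text \<open>Supplies the quadrangle that \<open>projective_plane\<close> demands: a third line takes
  at most one point from each pair, since two would make it \<open>l\<close> or
  \<open>m\<close>.\<close>

lemma quadrangle_two_lines:
  assumes "l \<in> L" "m \<in> L" "l \<noteq> m"
    and "a \<noteq> a'" "{a, a'} \<subseteq> pts l - pts m"
    and "b \<noteq> b'" "{b, b'} \<subseteq> pts m - pts l"
  shows "card {a, a', b, b'} = 4" and "k \<in> L \<Longrightarrow> card {x \<in> {a, a', b, b'}. I x k} \<le> 2"
proof -
  have "a \<noteq> b" "a \<noteq> b'" "a' \<noteq> b" "a' \<noteq> b'" using assms by blast+
  then show "card {a, a', b, b'} = 4" using assms by simp
  assume k: "k \<in> L"
  have P: "a \<in> P" "a' \<in> P" "b \<in> P" "b' \<in> P" using assms pts_iff by auto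
  have "\<exists>u v. {x \<in> {a, a', b, b'}. I x k} \<subseteq> {u, v}"
  proof -
    consider "k = l" | "k = m" | "k \<noteq> l" "k \<noteq> m" by blast
    then show ?thesis
    proof cases
      case 1
      then have "{x \<in> {a, a', b, b'}. I x k} \<subseteq> {a, a'}" using assms P by (auto simp: pts_iff)
      then show ?thesis by blast
    next
      case 2
      then have "{x \<in> {a, a', b, b'}. I x k} \<subseteq> {b, b'}" using assms P by (auto simp: pts_iff)
      then show ?thesis by blast
    next
      case 3
      have "\<not> (I a k \<and> I a' k)" "\<not> (I b k \<and> I b' k)"
        using 3 k assms P join_unique[of k l a a'] join_unique[of k m b b'] by (auto simp: pts_iff)
      then show ?thesis by blast
    qed
  qed
  then obtain u v where uv: "{x \<in> {a, a', b, b'}. I x k} \<subseteq> {u, v}" by blast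
  have "card {x \<in> {a, a', b, b'}. I x k} \<le> card {u, v}" using uv by (intro card_mono) auto
  also have "\<dots> \<le> 2" by (simp add: card_insert_if)
  finally show "card {x \<in> {a, a', b, b'}. I x k} \<le> 2" .
qed

end

section \<open>Line intersections of a balanced pair of point sets\<close>

locale balanced_pair = plane_of_order "p\<^sup>2" P L I
  for p :: nat and P :: "'a set" and L :: "'b set" and I :: "'a \<Rightarrow> 'b \<Rightarrow> bool" +
  fixes A B :: "'a set"
  assumes order_ge: "3 \<le> p"
    and sub: "A \<subseteq> P" "B \<subseteq> P" and disj: "A \<inter> B = {}" and fin: "finite A" "finite B"
    and balanced: "l \<in> L \<Longrightarrow> [card (A \<inter> pts l) = card (B \<inter> pts l)] (mod p)"
    and card_A_B: "card A = card B + p"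
    and small: "card A + card B + p \<le> 2 * p\<^sup>2"
begin

text \<open>If the line misses \<open>B\<close>, it meets \<open>A\<close> in a positive multiple of
  \<open>p\<close> points; otherwise one point of each set already contributes
  \<open>1 + (p - 1)\<close>. The factor \<open>p - 1\<close> is chosen so that the patterns
  \<open>(p, 0)\<close> and \<open>(1, 1)\<close> both attain the bound.\<close>

lemma line_meeting_A_ge:
  assumes "l \<in> L" "x \<in> A" "x \<in> pts l"
  shows "p \<le> card (A \<inter> pts l) + (p - 1) * card (B \<inter> pts l)"
proof -
  have pos: "card (A \<inter> pts l) > 0" using assms fin by (auto simp: card_gt_0_iff)
  show ?thesis
  proof (cases "card (B \<inter> pts l) = 0")
    case True
    then have "p dvd card (A \<inter> pts l)"
      using balanced[OF assms(1)] by (metis cong_0_iff)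
    then have "p \<le> card (A \<inter> pts l)" using pos by (rule dvd_imp_le)
    then show ?thesis by simp
  next
    case False
    then have "(p - 1) * 1 \<le> (p - 1) * card (B \<inter> pts l)" by (intro mult_le_mono2) simp
    then show ?thesis using pos by linarith
  qed
qed

text \<open>The summand \<open>p^2\<close> is the surplus from counting \<open>x\<close> on every
  line. The rest uses \<open>card_A_B\<close>, which makes the total a multiple of \<open>p\<close>,
  ready to be compared with \<open>p * (p^2 + 1)\<close>.\<close>

lemma sum_pencil_A:
  assumes "x \<in> A"
  shows "(\<Sum>l\<in>pencil x. card (A \<inter> pts l) + (p - 1) * card (B \<inter> pts l)) = p * card B + p + p\<^sup>2"
proof -
  have "x \<in> P" "x \<notin> B" using assms sub disj by auto
  then have "(\<Sum>l\<in>pencil x. card (A \<inter> pts l) + (p - 1) * card (B \<inter> pts l))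
      = card A + p\<^sup>2 + (p - 1) * card B"
    using sum_pencil_self[OF assms sub(1) fin(1)] sum_pencil[of x B] sub fin
    by (simp add: sum.distrib flip: sum_distrib_left)
  also have "\<dots> = p * card B + p + p\<^sup>2"
    using card_A_B order_ge by (cases p) auto
  finally show ?thesis .
qed

lemma A_nonempty: obtains x where "x \<in> A"
  using card_A_B order_ge fin by fastforce

text \<open>One inequality is \<open>small\<close> combined with \<open>card_A_B\<close>. For the
  other, each of the \<open>p^2 + 1\<close> lines through a point of \<open>A\<close> contributes at
  least \<open>p\<close>, so \<open>p^2 + 1 \<le> card B + 1 + p\<close>.\<close>

lemma card_B: "card B + p = p\<^sup>2"
proof (rule antisym)
  show "card B + p \<le> p\<^sup>2" using small card_A_B by simp
  obtain x where x: "x \<in> A" using A_nonempty .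
  then have xP: "x \<in> P" using sub by auto
  have "(\<Sum>l\<in>pencil x. p) \<le> (\<Sum>l\<in>pencil x. card (A \<inter> pts l) + (p - 1) * card (B \<inter> pts l))"
    using x by (intro sum_mono line_meeting_A_ge) (auto simp: pencil_def)
  then have "p * (p\<^sup>2 + 1) \<le> p * (card B + 1 + p)"
    using sum_pencil_A[OF x] finite_card_pencil[OF xP]
    by (simp add: algebra_simps power2_eq_square)
  then show "p\<^sup>2 \<le> card B + p" using order_ge by simp
qed

lemma card_A: "card A = p\<^sup>2"
  using card_A_B card_B by simp

text \<open>Given \<open>card_B\<close>, the sum over the pencil is exactly
  \<open>p * (p^2 + 1)\<close>, so the lower bound \<open>p\<close> is attained on every
  line.\<close>

lemma line_meeting_A_eq:
  assumes l: "l \<in> L" and x: "x \<in> A" "x \<in> pts l"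
  shows "card (A \<inter> pts l) + (p - 1) * card (B \<inter> pts l) = p"
proof -
  let ?f = "\<lambda>l. card (A \<inter> pts l) + (p - 1) * card (B \<inter> pts l)"
  have pen: "finite (pencil x)" "card (pencil x) = p\<^sup>2 + 1"
    using finite_card_pencil x pts_iff by auto
  have "p * card B + p + p\<^sup>2 = p * (card B + p) + p"
    by (simp add: algebra_simps power2_eq_square)
  then have "(\<Sum>l\<in>pencil x. ?f l) = (\<Sum>l\<in>pencil x. p)"
    using sum_pencil_A[OF x(1)] pen card_B by simp
  then have "\<forall>l\<in>pencil x. p = ?f l"
    using sum_mono_inv[of "\<lambda>_. p" "pencil x" ?f] pen line_meeting_A_ge x
    by (auto simp: pencil_def)
  then show ?thesis using l x by (auto simp: pencil_def)
qed

lemma line_meeting_A_cases: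
  assumes "l \<in> L" "x \<in> A" "x \<in> pts l"
  obtains "card (A \<inter> pts l) = p" "B \<inter> pts l = {}"
    | "card (A \<inter> pts l) = 1" "card (B \<inter> pts l) = 1"
proof -
  have pos: "card (A \<inter> pts l) > 0" using assms fin by (auto simp: card_gt_0_iff)
  have eq: "card (A \<inter> pts l) + (p - 1) * card (B \<inter> pts l) = p"
    using line_meeting_A_eq assms .
  show thesis
  proof (cases "card (B \<inter> pts l) = 0")
    case True
    then show thesis using that(1) eq fin by simp
  next
    case False
    have "(p - 1) * card (B \<inter> pts l) \<le> (p - 1) * 1" using eq pos by linarith
    then have "card (B \<inter> pts l) = 1" using False order_ge by simp
    then show thesis using that(2) eq order_ge by simp
  qed
qed

lemma line_meeting_both:
  assumes "l \<in> L" "x \<in> A" "x \<in> pts l" "y \<in> B" "y \<in> pts l"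
  shows "card (A \<inter> pts l) = 1" "card (B \<inter> pts l) = 1"
  using line_meeting_A_cases[OF assms(1-3)] assms(4,5) by auto

text \<open>Fix \<open>y\<close> in \<open>B\<close>. Exactly one line \<open>l\<close> through
  \<open>y\<close> misses \<open>A\<close>. Any other line through \<open>y\<close> meets both sets
  and so has no second point of \<open>B\<close>; hence all of \<open>B\<close> lies on
  \<open>l\<close>.\<close>

lemma B_collinear:
  obtains l where "l \<in> L" "B \<subseteq> pts l" "A \<inter> pts l = {}"
proof -
  have "p < p\<^sup>2" using order_ge by (simp add: power2_eq_square)
  then have "card B > 0" using card_B by simp
  then obtain y where y: "y \<in> B" by (auto simp: card_gt_0_iff)
  then have yP: "y \<in> P" "y \<notin> A" using sub disj by auto
  have pen: "finite (pencil y)" "card (pencil y) = p\<^sup>2 + 1" using finite_card_pencil yP by auto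
  \<comment> \<open>Otherwise the \<open>p^2 + 1\<close> lines through \<open>y\<close> would carry
    at least that many points of \<open>A\<close>, which has only \<open>p^2\<close>.\<close>
  have "\<exists>l\<in>pencil y. A \<inter> pts l = {}"
  proof (rule ccontr)
    assume "\<not> (\<exists>l\<in>pencil y. A \<inter> pts l = {})"
    then have "card (A \<inter> pts l) \<ge> 1" if "l \<in> pencil y" for l
      using that fin by (simp add: Suc_le_eq card_gt_0_iff)
    then have "(\<Sum>l\<in>pencil y. 1) \<le> (\<Sum>l\<in>pencil y. card (A \<inter> pts l))"
      by (intro sum_mono)
    then show False using sum_pencil[OF yP(1) sub(1) yP(2) fin(1)] pen card_A by simp
  qed
  then obtain l where l: "l \<in> pencil y" "A \<inter> pts l = {}" by blast
  \<comment> \<open>If two lines through \<open>y\<close> missed \<open>A\<close>, the remaining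
    \<open>p^2 - 1\<close> lines, with at most one point of \<open>A\<close> each, could not cover
    \<open>A\<close>.\<close>
  have others: "A \<inter> pts m \<noteq> {}" if m: "m \<in> pencil y" "m \<noteq> l" for m
  proof
    assume m0: "A \<inter> pts m = {}"
    have le: "card (A \<inter> pts k) \<le> 1" if k: "k \<in> pencil y" for k
    proof (cases "A \<inter> pts k = {}")
      case False
      then show ?thesis using line_meeting_both(1)[of k _ y] k y by (auto simp: pencil_def)
    qed simp
    have "card A = (\<Sum>k\<in>pencil y. card (A \<inter> pts k))"
      using sum_pencil[OF yP(1) sub(1) yP(2) fin(1)] by simp
    also have "\<dots> = (\<Sum>k\<in>pencil y - {l, m}. card (A \<inter> pts k))"
      using pen l m0 by (intro sum.mono_neutral_right) auto
    also have "\<dots> \<le> (\<Sum>k\<in>pencil y - {l, m}. 1)" using le by (intro sum_mono) auto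
    also have "\<dots> = p\<^sup>2 + 1 - 2"
      using pen l m by (simp add: card_Diff_subset)
    finally show False using card_A order_ge \<open>p < p\<^sup>2\<close> by simp
  qed
  have "B \<subseteq> pts l"
  proof
    fix z assume z: "z \<in> B"
    show "z \<in> pts l"
    proof (cases "z = y")
      case True then show ?thesis using l by (simp add: pencil_def)
    next
      case False
      then obtain m where m: "m \<in> L" "y \<in> pts m" "z \<in> pts m"
        using join_exists[of y z] yP z sub by blast
      have "m = l"
      proof (rule ccontr)
        assume "m \<noteq> l"
        then obtain x where "x \<in> A" "x \<in> pts m" using others[of m] m by (auto simp: pencil_def)
        then have "card (B \<inter> pts m) = 1" using line_meeting_both(2) m y by blast
        then obtain w where "B \<inter> pts m = {w}" by (auto simp: card_1_singleton_iff)
        then show False using y z m False by (metis IntI singletonD)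
      qed
      then show ?thesis using m by simp
    qed
  qed
  then show thesis using that l by (auto simp: pencil_def)
qed

section \<open>The Baer subplane, whose lines are \<open>l\<close> and the secants\<close>

definition secants :: "'b set" where
  "secants = {m \<in> L. card (A \<inter> pts m) = p \<and> B \<inter> pts m = {}}"

context
  fixes l
  assumes l: "l \<in> L" "B \<subseteq> pts l" "A \<inter> pts l = {}"
begin

lemma card_l_minus_B: "card (pts l - B) = p + 1"
  using card_pts[OF l(1)] card_Diff_subset[OF fin(2) l(2)] card_B by simp

lemma secant_meets_A:
  assumes "m \<in> secants" obtains x where "x \<in> A" "x \<in> pts m"
  using assms order_ge unfolding secants_def
  by (metis (mono_tags, lifting) IntE card.empty equals0I mem_Collect_eq not_numeral_le_zero)

lemma secant_meets_l:
  assumes "m \<in> secants"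
  shows "m \<noteq> l" and "\<exists>z. pts m \<inter> pts l = {z} \<and> z \<notin> B"
proof -
  show ne: "m \<noteq> l" using secant_meets_A[OF assms] l by blast
  have m: "m \<in> L" "B \<inter> pts m = {}" using assms by (auto simp: secants_def)
  obtain z where "z \<in> pts m" "z \<in> pts l" using meet_exists m l ne by metis
  then show "\<exists>z. pts m \<inter> pts l = {z} \<and> z \<notin> B" using join_unique[OF m(1) l(1)] ne m by blast
qed

text \<open>In the pattern \<open>(1, 1)\<close> the only point of \<open>A\<close> on
  \<open>m\<close> is \<open>x\<close>, so \<open>y\<close> is on \<open>l\<close> outside
  \<open>B\<close>. The point of \<open>B\<close> on \<open>m\<close> is a second point of
  \<open>l\<close>, which forces \<open>m = l\<close>, although \<open>l\<close> misses
  \<open>A\<close>.\<close>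

lemma secantI:
  assumes "m \<in> L" "x \<in> A" "x \<in> pts m" "y \<in> A \<union> (pts l - B)" "y \<in> pts m" "x \<noteq> y"
  shows "m \<in> secants"
  using assms(1-3)
proof (cases rule: line_meeting_A_cases)
  case 1
  then show ?thesis using assms by (simp add: secants_def)
next
  case 2
  obtain u v where uv: "A \<inter> pts m = {u}" "B \<inter> pts m = {v}"
    using 2 by (auto simp: card_1_singleton_iff)
  then have "y \<in> pts l - B" using assms by (metis IntI UnE singletonD)
  moreover have "v \<in> pts l" "v \<in> B" "v \<in> pts m" using uv l by auto
  ultimately have "m = l" using join_unique[of m l y v] assms l by blast
  then show ?thesis using assms l by blast
qed

text \<open>Suppose \<open>z\<close> lies outside. Then \<open>z\<close> is not on \<open>l\<close>,
  so each line through \<open>z\<close> has at most one point of \<open>B\<close> and, by the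
  congruence, at least as many points of \<open>A\<close>. The two secants miss \<open>B\<close> but
  carry \<open>2 * p\<close> points of \<open>A\<close>, so \<open>card A\<close> would be at least
  \<open>card B + 2 * p\<close>, contradicting \<open>card_A_B\<close>.\<close>

lemma secants_meet:
  assumes m: "m \<in> secants" "k \<in> secants" "m \<noteq> k" and z: "z \<in> pts m" "z \<in> pts k"
  shows "z \<in> A \<union> (pts l - B)"
proof (rule ccontr)
  assume no: "z \<notin> A \<union> (pts l - B)"
  have zP: "z \<in> P" "z \<notin> B" "z \<notin> A" using z pts_subset m no by (auto simp: secants_def)
  then have zl: "z \<notin> pts l" using no by blast
  have pen: "finite (pencil z)" using finite_card_pencil zP by auto
  have mk: "m \<in> pencil z" "k \<in> pencil z" "B \<inter> pts m = {}" "B \<inter> pts k = {}"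
    using m z by (auto simp: pencil_def secants_def)
  have one: "card (B \<inter> pts t) \<le> 1" if "t \<in> pencil z" for t
  proof (rule ccontr)
    assume "\<not> card (B \<inter> pts t) \<le> 1"
    then obtain u v where "u \<in> B \<inter> pts t" "v \<in> B \<inter> pts t" "u \<noteq> v"
      using fin by (auto simp: card_le_Suc0_iff_eq)
    then have "t = l" using join_unique[of t l u v] that l by (auto simp: pencil_def)
    then show False using that zl by (simp add: pencil_def)
  qed
  \<comment> \<open>A line meeting \<open>B\<close> exactly once cannot miss \<open>A\<close>, by the congruence modulo \<open>p\<close>.\<close>
  have T: "card (B \<inter> pts t) \<le> card (A \<inter> pts t)" if "t \<in> pencil z" for t
  proof (rule ccontr)
    assume "\<not> card (B \<inter> pts t) \<le> card (A \<inter> pts t)"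
    then have "card (A \<inter> pts t) = 0" "card (B \<inter> pts t) = 1" using one[OF that] by auto
    then have "[0 = 1] (mod p)" using balanced[of t] that by (auto simp: pencil_def)
    then show False using order_ge by (simp add: cong_def)
  qed
  have sB: "(\<Sum>t\<in>pencil z. card (B \<inter> pts t)) = card B"
    using sum_pencil zP sub fin by blast
  have "(\<Sum>t\<in>pencil z - {m, k}. card (B \<inter> pts t)) = (\<Sum>t\<in>pencil z. card (B \<inter> pts t))"
    using pen mk by (intro sum.mono_neutral_left) auto
  then have "card B \<le> (\<Sum>t\<in>pencil z - {m, k}. card (A \<inter> pts t))"
    using sum_mono[of "pencil z - {m, k}" "\<lambda>t. card (B \<inter> pts t)" "\<lambda>t. card (A \<inter> pts t)"] T sB
    by auto
  moreover have "(\<Sum>t\<in>{m, k}. card (A \<inter> pts t)) = 2 * p"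
    using m by (simp add: secants_def)
  moreover have "(\<Sum>t\<in>pencil z. card (A \<inter> pts t))
      = (\<Sum>t\<in>pencil z - {m, k}. card (A \<inter> pts t)) + (\<Sum>t\<in>{m, k}. card (A \<inter> pts t))"
    using pen mk by (intro sum.subset_diff) auto
  moreover have "(\<Sum>t\<in>pencil z. card (A \<inter> pts t)) = card A" using sum_pencil zP sub fin by blast
  ultimately show False using card_A_B order_ge by linarith
qed

text \<open>Joins come from \<open>secantI\<close>, or are \<open>l\<close> itself; intersections
  come from \<open>secants_meet\<close> and \<open>secant_meets_l\<close>. A secant has
  \<open>p\<close> points in \<open>A\<close> and one more on \<open>l\<close>.\<close>

lemma baer_subplane:
  "subplane_of_order p (A \<union> (pts l - B)) (insert l secants) P L I"
proof -
  let ?S = "A \<union> (pts l - B)" and ?M = "insert l secants"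
  have S_sub: "?S \<subseteq> P" using sub pts_subset by auto
  have M_sub: "?M \<subseteq> L" using l by (auto simp: secants_def)
  have join: "\<exists>m\<in>?M. x \<in> pts m \<and> y \<in> pts m" if xy: "x \<in> ?S" "y \<in> ?S" "x \<noteq> y" for x y
  proof -
    obtain m where m: "m \<in> L" "x \<in> pts m" "y \<in> pts m" using join_exists xy S_sub by blast
    show ?thesis
    proof (cases "x \<in> A \<or> y \<in> A")
      case True
      then have "m \<in> secants" using secantI[of m x y] secantI[of m y x] xy m by blast
      then show ?thesis using m by blast
    next
      case False
      then show ?thesis using xy by blast
    qed
  qed
  have meet: "\<exists>z\<in>?S. z \<in> pts m \<and> z \<in> pts k" if mk: "m \<in> ?M" "k \<in> ?M" "m \<noteq> k" for m k
  proof (cases "m = l \<or> k = l")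
    case True
    then show ?thesis using secant_meets_l(2)[of m] secant_meets_l(2)[of k] mk by blast
  next
    case False
    obtain z where "z \<in> pts m" "z \<in> pts k" using meet_exists mk M_sub by blast
    then show ?thesis using secants_meet[of m k z] mk False by blast
  qed
  have card: "card (line_points ?S I m) = p + 1" if m: "m \<in> ?M" for m
  proof -
    have eq: "line_points ?S I m = ?S \<inter> pts m" using S_sub by (auto simp: line_points_def)
    show ?thesis
    proof (cases "m = l")
      case True
      then have "?S \<inter> pts m = pts l - B" using l by auto
      then show ?thesis using eq card_l_minus_B by simp
    next
      case False
      then have ms: "m \<in> secants" using m by simp
      then obtain z where z: "pts m \<inter> pts l = {z}" "z \<notin> B" using secant_meets_l by blast
      then have "?S \<inter> pts m = insert z (A \<inter> pts m)" "z \<notin> A" using l by auto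
      then show ?thesis using eq ms fin by (simp add: secants_def)
    qed
  qed
  have "\<exists>Q\<subseteq>?S. card Q = 4 \<and> (\<forall>k\<in>?M. card {x \<in> Q. I x k} \<le> 2)"
  proof -
    obtain x where x: "x \<in> A" using A_nonempty .
    have "pts l - B \<noteq> {}" using card_l_minus_B by force
    then obtain y where y: "y \<in> pts l - B" by blast
    \<comment> \<open>This shows that a secant exists: the join passes through a point of
      \<open>A\<close>, so it is not \<open>l\<close>. The quadrangle takes two points of
      \<open>A\<close> on \<open>m\<close> and two of the \<open>p\<close> points of
      \<open>pts l - B\<close> other than \<open>z\<close>.\<close>
    obtain m where m: "m \<in> ?M" "x \<in> pts m" "y \<in> pts m" using join[of x y] x y l by blast
    have ms: "m \<in> secants" using m x l by blast
    obtain z where z: "pts m \<inter> pts l = {z}" using secant_meets_l ms by blast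
    have "2 \<le> card (A \<inter> pts m)" using ms order_ge by (simp add: secants_def)
    then obtain T where T: "T \<subseteq> A \<inter> pts m" "card T = 2"
      using obtain_subset_with_card_n by metis
    then obtain a a' where a: "T = {a, a'}" "a \<noteq> a'" by (auto simp: card_2_iff)
    have "2 \<le> card (pts l - B - {z})"
      using card_l_minus_B order_ge by (simp add: card_Diff_singleton_if)
    then obtain U where U: "U \<subseteq> pts l - B - {z}" "card U = 2"
      using obtain_subset_with_card_n by metis
    then obtain b b' where b: "U = {b, b'}" "b \<noteq> b'" by (auto simp: card_2_iff)
    have "m \<in> L" "m \<noteq> l" using ms secant_meets_l by (auto simp: secants_def)
    moreover have "{a, a'} \<subseteq> pts m - pts l" using T a l by auto
    moreover have "{b, b'} \<subseteq> pts l - pts m" using U b z by auto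
    ultimately have "card {a, a', b, b'} = 4" "\<And>k. k \<in> L \<Longrightarrow> card {x \<in> {a, a', b, b'}. I x k} \<le> 2"
      using quadrangle_two_lines[of m l a a' b b'] l a b by auto
    moreover have "{a, a', b, b'} \<subseteq> ?S" using T U a b by auto
    ultimately show ?thesis using M_sub by blast
  qed
  moreover have "\<exists>!m. m \<in> ?M \<and> I x m \<and> I y m" if "x \<in> ?S" "y \<in> ?S" "x \<noteq> y" for x y
  proof (rule ex_ex1I)
    show "\<exists>m. m \<in> ?M \<and> I x m \<and> I y m" using join[OF that] pts_iff by blast
    fix m k assume "m \<in> ?M \<and> I x m \<and> I y m" "k \<in> ?M \<and> I x k \<and> I y k"
    moreover from this have "x \<in> pts m" "y \<in> pts m" "x \<in> pts k" "y \<in> pts k"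
      using that S_sub pts_iff by blast+
    ultimately show "m = k" using join_unique[of m k x y] that M_sub by blast
  qed
  moreover have "\<exists>!z. z \<in> ?S \<and> I z m \<and> I z k" if "m \<in> ?M" "k \<in> ?M" "m \<noteq> k" for m k
  proof (rule ex_ex1I)
    show "\<exists>z. z \<in> ?S \<and> I z m \<and> I z k" using meet[OF that] pts_iff by blast
    fix z w assume "z \<in> ?S \<and> I z m \<and> I z k" "w \<in> ?S \<and> I w m \<and> I w k"
    then have "z \<in> pts m" "z \<in> pts k" "w \<in> pts m" "w \<in> pts k" using S_sub pts_iff by blast+
    then show "z = w" using join_unique[of m k z w] that M_sub by blast
  qed
  ultimately show ?thesis
    unfolding subplane_of_order_def projective_plane_of_order_def projective_plane_def
    by (intro conjI ballI impI S_sub M_sub card)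
qed

end

text \<open>Writing \<open>A\<close> and \<open>B\<close> as the two set differences is what allows
  the codeword to be read as a difference of incidence vectors.\<close>

theorem exists_baer_subplane:
  "\<exists>S M l. subplane_of_order p S M P L I \<and> l \<in> L \<and> card (S \<inter> pts l) = p + 1 \<and>
     A = S - pts l \<and> B = pts l - S"
proof -
  obtain l where l: "l \<in> L" "B \<subseteq> pts l" "A \<inter> pts l = {}" using B_collinear .
  let ?S = "A \<union> (pts l - B)"
  have "?S \<inter> pts l = pts l - B" "A = ?S - pts l" "B = pts l - ?S" using l disj by auto
  then show ?thesis using baer_subplane[OF l] card_l_minus_B[OF l] l(1) by metis
qed

end

section \<open>From the codeword to a balanced pair and back\<close>

theorem mainTheorem7:
  fixes P :: "'a set" and L :: "'b set" and I :: "'a \<Rightarrow> 'b \<Rightarrow> bool"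
    and p \<epsilon> :: nat and c :: "'a \<Rightarrow> int"
  assumes "prime p" and "p \<ge> 3"
    and "projective_plane_of_order (p^2) P L I"
    and "c \<in> dual_code p P L I"
    and "weight P c = 2 * p^2 - 2 * p + 2 + \<epsilon>"
    and "1 \<le> \<epsilon>" and "\<epsilon> \<le> p - 2"
    and "\<forall>x\<in>P. c x \<noteq> 0 \<longrightarrow> c x = 1 \<or> c x = int p - 1"
    and "\<bar>int (card {x \<in> P. c x = 1}) - int (card {x \<in> P. c x = int p - 1})\<bar> = int p"
  shows "\<exists>B M l. subplane_of_order p B M P L I \<and> l \<in> L \<and>
           card (B \<inter> line_points P I l) = p + 1 \<and>
           (c = vec_diff p P (incidence_vector P B) (incidence_vector P (line_points P I l)) \<or>
            c = vec_diff p P (incidence_vector P (line_points P I l)) (incidence_vector P B))"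
proof -
  interpret plane_of_order "p\<^sup>2" P L I using assms(3) by unfold_locales
  define A where "A = {x \<in> P. c x = 1}"
  define B where "B = {x \<in> P. c x = int p - 1}"
  have sub: "A \<subseteq> P" "B \<subseteq> P" and disj: "A \<inter> B = {}" using assms(2) by (auto simp: A_def B_def)
  have supp: "{x \<in> P. c x \<noteq> 0} = A \<union> B" using assms(2,8) by (auto simp: A_def B_def)
  have W: "card (A \<union> B) = 2 * p^2 - 2 * p + 2 + \<epsilon>" using assms(5) supp by (simp add: weight_def)
  \<comment> \<open>An infinite set has \<open>card\<close> equal to 0, so the positive weight makes
    the support finite.\<close>
  then have "finite (A \<union> B)" by (metis add_2_eq_Suc' add_Suc_shift card.infinite nat.distinct(1) add_Suc)
  then have fin: "finite A" "finite B" by auto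
  \<comment> \<open>Ensures that the natural subtraction in the weight does not truncate; with
    \<open>\<epsilon> \<le> p - 2\<close> the weight is then at most
    \<open>2 * p^2 - p\<close>.\<close>
  have "p \<le> p\<^sup>2" using assms(2) by (simp add: power2_eq_square)
  then have small: "card A + card B + p \<le> 2 * p\<^sup>2"
    using W card_Un_disjoint[OF fin disj] assms(2,7) by linarith
  have ext: "c \<in> extensional P" using assms(4) by (auto simp: dual_code_def Fp_vectors_def PiE_def)
  \<comment> \<open>The entry \<open>p - 1\<close> acts as \<open>-1\<close> modulo
    \<open>p\<close>, so the sum of \<open>c\<close> over a line is the difference of the two
    intersection sizes.\<close>
  have bal: "[card (A \<inter> pts l) = card (B \<inter> pts l)] (mod p)" if l: "l \<in> L" for l
  proof -
    have c: "c x = of_bool (x \<in> A) + (int p - 1) * of_bool (x \<in> B)" if "x \<in> pts l" for x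
      using that assms(2,8) pts_subset[of l] by (auto simp: A_def B_def)
    have fl: "finite (pts l)" using finite_pts l .
    have "(\<Sum>x\<in>pts l. c x) = (\<Sum>x\<in>pts l. of_bool (x \<in> A) + (int p - 1) * of_bool (x \<in> B))"
      using c by (rule sum.cong[OF refl])
    also have "\<dots> = int (card (A \<inter> pts l)) + (int p - 1) * int (card (B \<inter> pts l))"
      using fl by (simp add: sum.distrib flip: sum_distrib_left) (simp add: Int_def conj_commute)
    finally have "[int (card (A \<inter> pts l)) + (int p - 1) * int (card (B \<inter> pts l)) = 0] (mod int p)"
      using assms(4) l unfolding dual_code_def by (metis (mono_tags, lifting) mem_Collect_eq)
    then have "int p dvd int (card (A \<inter> pts l)) - int (card (B \<inter> pts l))
        + int p * int (card (B \<inter> pts l))"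
      by (simp add: cong_0_iff algebra_simps)
    then have "int p dvd int (card (A \<inter> pts l)) - int (card (B \<inter> pts l))"
      by (simp add: dvd_add_left_iff)
    then show ?thesis by (simp add: cong_iff_dvd_diff flip: cong_int_iff)
  qed
  \<comment> \<open>Common points of \<open>S\<close> and \<open>T\<close> cancel, and points of
    \<open>T\<close> alone give \<open>-1\<close>, represented by \<open>p - 1\<close>. Outside
    \<open>P\<close> both sides are \<open>undefined\<close>.\<close>
  have vec: "c = vec_diff p P (incidence_vector P S) (incidence_vector P T)"
    if "A = S - T" "B = T - S" for S T
  proof
    fix x
    have "(- 1) mod int p = int p - 1" using assms(2) by (simp add: zmod_minus1)
    then show "c x = vec_diff p P (incidence_vector P S) (incidence_vector P T) x"
      using that assms(2,8) ext
      by (cases "x \<in> P"; cases "x \<in> S"; cases "x \<in> T")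
        (auto simp: vec_diff_def incidence_vector_def extensional_def A_def B_def)
  qed
  \<comment> \<open>The locale needs the larger set first. Swapping the sets corresponds to negating
    \<open>c\<close>, so the two cases yield the two signs in the conclusion.\<close>
  have "card A = card B + p \<or> card B = card A + p"
    using assms(9) unfolding A_def B_def by linarith
  then show ?thesis
  proof
    assume d: "card A = card B + p"
    interpret balanced_pair p P L I A B
      using assms(2) sub disj fin bal d small by unfold_locales auto
    show ?thesis using exists_baer_subplane vec by metis
  next
    assume d: "card B = card A + p"
    interpret balanced_pair p P L I B A
      using assms(2) sub disj fin bal d small by unfold_locales (auto intro: cong_sym)
    show ?thesis using exists_baer_subplane vec by metis
  qed
qed

end
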